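(* Assume the setting and notation of the context, with $B>1$, $B>B_0$, and $\mathbf W\succ\mathbf 0$. Let $\|\mathbf v\|_{Q,\infty}=\max_{\alpha\in\mathcal E_s}|\mathbf q_\alpha^\top\mathbf v|$ and let $\mathcal A_N$ be the set of all maps $\hat\theta:\mathcal Y_N\to\mathbb R^{d_\theta}$ with $\sup_{\theta\in\Theta_B}\mathbb E_\theta^{(N)}[\|\hat\theta-\theta\|_{Q,\infty}^2]<\infty$. Then there is an absolute constant $c_0>0$ such that $$\inf_{\hat\theta\in\mathcal A_N}\ \sup_{\theta\in\Theta_B}\ \mathbb E_\theta^{(N)}\big[\|\hat\theta-\theta\|_{Q,\infty}^2\big]\ \ge\ c_0\min\Big\{\frac{\mu_Qd_\theta\sigma^2}{N},\ \sigma^2\log^2(B/B_0)\Big\},$$ and moreover $$\inf_{\hat\theta\in\mathcal A_N}\ \sup_{\theta\in\Theta_B}\ \mathbb P_\theta^{(N)}\Big\{\|\hat\theta-\theta\|_{Q,\infty}^2\ \ge\ \min\Big\{\frac{\mu_Qd_\theta\sigma^2}{N},\ \sigma^2\log^2(B/B_0)\Big\}\Big\}\ \ge\ \frac14 .$$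
   Context: Model (Bradley–Terry–Luce with linear-in-parameter utility). Fix an integer $d\ge2$, feature vectors $\phi(\mathbf x_1),\dots,\phi(\mathbf x_d)\in\mathbb R^p$, the matrix $\mathfrak A\in\mathbb R^{d\times p}$ with rows $\phi(\mathbf x_i)^\top$, a scale $\sigma>0$, and a consistent linear system $\mathbf A\mathbf w=\mathbf b$ with $\mathbf A\in\mathbb R^{l\times p}$, $\mathbf b\in\mathbb R^l$. Let $r_A=\mathrm{rank}(\mathbf A)$, $d_\theta=p-r_A\ge1$, let $\mathbf V\in\mathbb R^{p\times d_\theta}$ have orthonormal columns spanning $\mathrm{Null}(\mathbf A)$, and $\mathbf w_o=\mathbf A^\dagger\mathbf b$. Feasible parameters are $\mathbf w=\mathbf w_o+\mathbf V\theta$, $\theta\in\mathbb R^{d_\theta}$. Design: a nonempty set of queries $\mathcal E_s\subseteq\{(i,j):1\le i<j\le d\}$ and integers $n_\alpha\ge1$ ($\alpha\in\mathcal E_s$); $N=\sum_{\alpha\in\mathcal E_s}n_\alpha$. For $\alpha=(i,j)$: $\mathbf a_\alpha=\mathfrak A^\top(\mathbf e_i-\mathbf e_j)$, $\mathbf q_\alpha=\mathbf V^\top\mathbf a_\alpha$, $\eta_\alpha(\theta)=(\mathbf w_o^\top\mathbf a_\alpha+\mathbf q_\alpha^\top\theta)/\sigma$. Responses: $Y^{(N)}=(Y_\alpha^{(t)})_{\alpha\in\mathcal E_s,t\in[n_\alpha]}\in\mathcal Y_N:=\{0,1\}^N$. Under $\mathbb P_\theta^{(N)}$ (expectation $\mathbb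 E_\theta^{(N)}$) the coordinates are independent and $Y_\alpha^{(t)}$ is Bernoulli with success probability $1/(1+e^{-\eta_\alpha(\theta)})$. An estimator $\hat\theta$ means $\hat\theta(Y^{(N)})$. Design matrix: $\mathbf W=\frac1N\sum_{\alpha\in\mathcal E_s}n_\alpha\mathbf q_\alpha\mathbf q_\alpha^\top\in\mathbb R^{d_\theta\times d_\theta}$. Coherence level (when $\mathbf W\succ\mathbf 0$): $\mu_Q=\max_{\alpha\in\mathcal E_s}\frac1{d_\theta}\mathbf q_\alpha^\top\mathbf W^{-1}\mathbf q_\alpha$. Parameter set: $\Theta_B=\{\theta\in\mathbb R^{d_\theta}:|\eta_\alpha(\theta)|\le\log B\ \forall\alpha\in\mathcal E_s\}$. The constant $B_0$ is defined by $\log B_0=\max_{\alpha\in\mathcal E_s}|\mathbf w_o^\top\mathbf a_\alpha/\sigma|$. "Absolute constant" means a number independent of all quantities in the problem. *)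

theory Defs
  imports
    "HOL-Probability.Probability"
    "Jordan_Normal_Form.DL_Rank"
    "Jordan_Normal_Form.Matrix_Kernel"
    "Jordan_Normal_Form.Gauss_Jordan_Elimination"
begin

text \<open>
  Vectors and matrices are those of Jordan_Normal_Form, whose dimensions are natural numbers:
  the absolute constant of the theorem has to be chosen before all the dimensions, so these must be
  quantifiable inside the formula. Indices run from 0, so the items are \<open>0, \<dots>, d - 1\<close>.
\<close>

definition is_pseudo_inverse :: "real mat \<Rightarrow> real mat \<Rightarrow> bool" where
  "is_pseudo_inverse A X \<longleftrightarrow>
     X \<in> carrier_mat (dim_col A) (dim_row A) \<and>
     A * X * A = A \<and> X * A * X = X \<and>
     transpose_mat (A * X) = A * X \<and> transpose_mat (X * A) = X * A"

text \<open>The Moore-Penrose inverse, characterised by the four Penrose equations.\<close>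

definition pseudo_inverse :: "real mat \<Rightarrow> real mat" where
  "pseudo_inverse A = (THE X. is_pseudo_inverse A X)"

definition positive_definite :: "real mat \<Rightarrow> bool" where
  "positive_definite M \<longleftrightarrow> square_mat M \<and> transpose_mat M = M \<and>
     (\<forall>x \<in> carrier_vec (dim_row M). x \<noteq> 0\<^sub>v (dim_row M) \<longrightarrow> scalar_prod x (M *\<^sub>v x) > 0)"

type_synonym query = "nat \<times> nat"

record btl =
  feat :: "real mat"           (* the d x p matrix whose rows are the feature vectors *)
  scale :: real                (* sigma *)
  cmat :: "real mat"           (* A *)
  crhs :: "real vec"           (* b *)
  nullbasis :: "real mat"      (* V *)
  queries :: "query set"       (* E_s *)
  reps :: "query \<Rightarrow> nat"  (* alpha |-> n_alpha, relevant on E_s only *)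

definition d_theta :: "btl \<Rightarrow> nat" where
  "d_theta M = dim_col (cmat M) - vec_space.rank (dim_row (cmat M)) (cmat M)"

definition btl_setting :: "nat \<Rightarrow> nat \<Rightarrow> nat \<Rightarrow> btl \<Rightarrow> bool" where
  "btl_setting d p l M \<longleftrightarrow>
     d \<ge> 2 \<and> feat M \<in> carrier_mat d p \<and> scale M > 0 \<and>
     cmat M \<in> carrier_mat l p \<and> crhs M \<in> carrier_vec l \<and>
     (\<exists>w \<in> carrier_vec p. cmat M *\<^sub>v w = crhs M) \<and>
     d_theta M \<ge> 1 \<and>
     nullbasis M \<in> carrier_mat p (d_theta M) \<and>
     transpose_mat (nullbasis M) * nullbasis M = 1\<^sub>m (d_theta M) \<and>
     vec_space.col_space p (nullbasis M) = mat_kernel (cmat M) \<and>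
     queries M \<noteq> {} \<and> queries M \<subseteq> {(i, j). i < j \<and> j < d} \<and>
     (\<forall>\<alpha> \<in> queries M. reps M \<alpha> \<ge> 1)"

definition w_o :: "btl \<Rightarrow> real vec" where
  "w_o M = pseudo_inverse (cmat M) *\<^sub>v crhs M"

definition a_vec :: "btl \<Rightarrow> query \<Rightarrow> real vec" where
  "a_vec M = (\<lambda>(i, j). transpose_mat (feat M) *\<^sub>v
     (unit_vec (dim_row (feat M)) i - unit_vec (dim_row (feat M)) j))"

definition q_vec :: "btl \<Rightarrow> query \<Rightarrow> real vec" where
  "q_vec M \<alpha> = transpose_mat (nullbasis M) *\<^sub>v a_vec M \<alpha>"

definition eta :: "btl \<Rightarrow> query \<Rightarrow> real vec \<Rightarrow> real" where
  "eta M \<alpha> \<theta> =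
     (scalar_prod (w_o M) (a_vec M \<alpha>) + scalar_prod (q_vec M \<alpha>) \<theta>) / scale M"

definition sample_size :: "btl \<Rightarrow> nat" where
  "sample_size M = (\<Sum>\<alpha> \<in> queries M. reps M \<alpha>)"

definition W_mat :: "btl \<Rightarrow> real mat" where
  "W_mat M = Matrix.mat (d_theta M) (d_theta M) (\<lambda>(r, s).
     1 / real (sample_size M) *
     (\<Sum>\<alpha> \<in> queries M. real (reps M \<alpha>) *
        (vec_index (q_vec M \<alpha>) r * vec_index (q_vec M \<alpha>) s)))"

text \<open>Meaningful for invertible \<open>W_mat M\<close> only, since \<open>mat_inverse\<close> returns an option.\<close>

definition mu_Q :: "btl \<Rightarrow> real" where
  "mu_Q M = Max ((\<lambda>\<alpha>. 1 / real (d_theta M) *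
     scalar_prod (q_vec M \<alpha>) (the (mat_inverse (W_mat M)) *\<^sub>v q_vec M \<alpha>)) ` queries M)"

definition Theta :: "btl \<Rightarrow> real \<Rightarrow> real vec set" where
  "Theta M B = {\<theta> \<in> carrier_vec (d_theta M). \<forall>\<alpha> \<in> queries M. \<bar>eta M \<alpha> \<theta>\<bar> \<le> ln B}"

definition B0 :: "btl \<Rightarrow> real" where
  "B0 M = exp (Max ((\<lambda>\<alpha>. \<bar>scalar_prod (w_o M) (a_vec M \<alpha>) / scale M\<bar>) ` queries M))"

definition Q_norm :: "btl \<Rightarrow> real vec \<Rightarrow> real" where
  "Q_norm M v = Max ((\<lambda>\<alpha>. \<bar>scalar_prod (q_vec M \<alpha>) v\<bar>) ` queries M)"

definition obs_index :: "btl \<Rightarrow> (query \<times> nat) set" where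
  "obs_index M = (SIGMA \<alpha> : queries M. {1..reps M \<alpha>})"

text \<open>
  A response vector is a function on the observation indices with \<open>True\<close> for 1 and \<open>False\<close> for 0,
  extended by \<open>False\<close> to all other arguments; this is the support of \<open>response_pmf\<close>.
\<close>

type_synonym response = "query \<times> nat \<Rightarrow> bool"

definition responses :: "btl \<Rightarrow> response set" where
  "responses M = PiE_dflt (obs_index M) False (\<lambda>_. UNIV)"

definition response_pmf :: "btl \<Rightarrow> real vec \<Rightarrow> response pmf" where
  "response_pmf M \<theta> = Pi_pmf (obs_index M) False
     (\<lambda>(\<alpha>, t). bernoulli_pmf (1 / (1 + exp (- eta M \<alpha> \<theta>))))"

text \<open>
  Risks are extended nonnegative, so that suprema and infima below need no boundedness or
  nonemptiness side conditions. The values of an estimator outside \<open>responses M\<close> are irrelevant.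
\<close>

definition risk :: "btl \<Rightarrow> (response \<Rightarrow> real vec) \<Rightarrow> real vec \<Rightarrow> ennreal" where
  "risk M est \<theta> =
     (\<integral>\<^sup>+ y. ennreal ((Q_norm M (est y - \<theta>))\<^sup>2) \<partial>measure_pmf (response_pmf M \<theta>))"

definition estimators :: "btl \<Rightarrow> real \<Rightarrow> (response \<Rightarrow> real vec) set" where
  "estimators M B = {est. (\<forall>y \<in> responses M. est y \<in> carrier_vec (d_theta M)) \<and>
     (SUP \<theta> \<in> Theta M B. risk M est \<theta>) < \<infinity>}"

definition min_rate :: "btl \<Rightarrow> real \<Rightarrow> real" where
  "min_rate M B = min
     (mu_Q M * real (d_theta M) * (scale M)\<^sup>2 / real (sample_size M))
     ((scale M)\<^sup>2 * (ln (B / B0 M))\<^sup>2)"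

end

theory Submission
  imports Defs
begin

text \<open>
  Le Cam's two-point method. Let \<open>\<alpha>\<close> maximise the leverage \<open>s\<^sup>2 = q\<^sub>\<alpha> \<bullet> W\<^sup>-\<^sup>1 q\<^sub>\<alpha>\<close>, let
  \<open>\<delta>\<^sup>2\<close> be the claimed rate, and test \<open>v = (\<delta> / s\<^sup>2) W\<^sup>-\<^sup>1 q\<^sub>\<alpha>\<close> against \<open>-v\<close>. By Cauchy-Schwarz for
  \<open>W\<^sup>-\<^sup>1\<close> no query sees \<open>v\<close> more than \<open>\<alpha>\<close> does, so both points are feasible, while \<open>q\<^sub>\<alpha>\<close> separates
  them by \<open>2 \<delta>\<close>. The squared Hellinger affinity of two Bernoulli laws with logits \<open>\<eta>\<close> and \<open>\<zeta>\<close> is at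
  least \<open>1 - tanh\<^sup>2 ((\<eta> - \<zeta>) / 4) \<ge> 1 - (\<eta> - \<zeta>)\<^sup>2 / 16\<close>; since the squared logit gaps sum to at most 4,
  that of the two samples is at least \<open>3 / 4\<close>. Hence the total variation distance is at most
  \<open>1 / 2\<close>, and every estimator errs by \<open>\<delta>\<close> with probability \<open>1 / 4\<close> at one of the two points.
\<close>

section \<open>Hellinger affinity and the testing error between two laws\<close>

definition bhattacharyya :: "'a set \<Rightarrow> 'a pmf \<Rightarrow> 'a pmf \<Rightarrow> real" where
  "bhattacharyya S p q = (\<Sum>x\<in>S. sqrt (pmf p x * pmf q x))"

text \<open>Cauchy-Schwarz for the square roots of the masses. The bound is what Weierstrass'
  product inequality asks of each factor in \<open>bhattacharyya_logistic_product\<close>.\<close>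

lemma bhattacharyya_sq_le_1:
  assumes "finite S" "set_pmf p \<subseteq> S" "set_pmf q \<subseteq> S"
  shows "(bhattacharyya S p q)\<^sup>2 \<le> 1"
proof -
  have "(bhattacharyya S p q)\<^sup>2 \<le> (\<Sum>x\<in>S. (sqrt (pmf p x))\<^sup>2) * (\<Sum>x\<in>S. (sqrt (pmf q x))\<^sup>2)"
    unfolding bhattacharyya_def real_sqrt_mult by (rule Cauchy_Schwarz_ineq_sum)
  also have "\<dots> = 1"
    using assms by (simp add: sum_pmf_eq_1)
  finally show ?thesis .
qed

text \<open>The overlap \<open>m\<close>, the sum of the pointwise minima, is one minus the total
  variation distance. Writing each product of masses as minimum times maximum, Cauchy-Schwarz bounds
  the squared affinity by \<open>m * (2 - m)\<close>. Every outcome lies in \<open>A\<close> or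
  \<open>B\<close>, so it contributes at least its smaller mass to the two probabilities.\<close>

lemma le_cam_two_point:
  fixes p q :: "'a pmf"
  assumes S: "finite S" "set_pmf p \<subseteq> S" "set_pmf q \<subseteq> S"
    and cover: "S \<subseteq> A \<union> B"
  shows "1 - sqrt (1 - (bhattacharyya S p q)\<^sup>2) \<le> measure_pmf.prob p A + measure_pmf.prob q B"
proof -
  define m where "m = (\<Sum>x\<in>S. min (pmf p x) (pmf q x))"
  have max_eq: "max a b = a + b - min a b" for a b :: real
    by (simp add: max_def min_def)
  have max: "(\<Sum>x\<in>S. max (pmf p x) (pmf q x)) = 2 - m"
    using S by (simp add: max_eq sum.distrib sum_subtractf sum_pmf_eq_1 m_def)
  have minmax: "pmf p x * pmf q x = min (pmf p x) (pmf q x) * max (pmf p x) (pmf q x)" for x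
    by (simp add: max_def min_def)
  have "(bhattacharyya S p q)\<^sup>2 \<le>
      (\<Sum>x\<in>S. (sqrt (min (pmf p x) (pmf q x)))\<^sup>2) * (\<Sum>x\<in>S. (sqrt (max (pmf p x) (pmf q x)))\<^sup>2)"
    unfolding bhattacharyya_def minmax real_sqrt_mult by (rule Cauchy_Schwarz_ineq_sum)
  also have "\<dots> = (\<Sum>x\<in>S. min (pmf p x) (pmf q x)) * (\<Sum>x\<in>S. max (pmf p x) (pmf q x))"
    by (simp add: le_max_iff_disj)
  also have "\<dots> = m * (2 - m)"
    unfolding max m_def ..
  \<comment> \<open>Completes the square: \<open>m * (2 - m) = 1 - (1 - m)^2\<close>.\<close>
  finally have "(1 - m)\<^sup>2 \<le> 1 - (bhattacharyya S p q)\<^sup>2"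
    by (simp add: power2_eq_square algebra_simps)
  then have bc: "1 - m \<le> sqrt (1 - (bhattacharyya S p q)\<^sup>2)"
    by (rule real_le_rsqrt)
  have prob: "measure_pmf.prob r C = (\<Sum>x\<in>S. if x \<in> C then pmf r x else 0)"
    if "set_pmf r \<subseteq> S" for r :: "'a pmf" and C
  proof -
    have "measure_pmf.prob r C = measure_pmf.prob r (C \<inter> S)"
      using that by (intro measure_prob_cong_0) (auto simp: set_pmf_eq)
    also have "\<dots> = (\<Sum>x\<in>C \<inter> S. pmf r x)"
      using S by (intro measure_measure_pmf_finite) auto
    also have "\<dots> = (\<Sum>x\<in>S. if x \<in> C then pmf r x else 0)"
      using S(1) by (subst Int_commute) (rule sum.inter_restrict)
    finally show ?thesis .
  qed
  have "m \<le> measure_pmf.prob p A + measure_pmf.prob q B"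
    unfolding m_def prob[OF S(2)] prob[OF S(3)] sum.distrib[symmetric]
    by (intro sum_mono) (use cover in \<open>auto simp: min_def\<close>)
  with bc show ?thesis by simp
qed

text \<open>Joint masses factor, so the distributive law turns the product of coordinate sums into
  one sum over joint outcomes.\<close>

lemma bhattacharyya_Pi_pmf:
  fixes p q :: "'i \<Rightarrow> 'b :: finite pmf"
  assumes "finite I"
  shows "bhattacharyya (PiE_dflt I d (\<lambda>_. UNIV)) (Pi_pmf I d p) (Pi_pmf I d q) =
    (\<Prod>i\<in>I. bhattacharyya UNIV (p i) (q i))"
proof -
  have sqrt_prod: "sqrt (prod f I) = (\<Prod>i\<in>I. sqrt (f i))" for f :: "'i \<Rightarrow> real"
    by (induction I rule: infinite_finite_induct) (simp_all add: real_sqrt_mult)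
  have "(\<Prod>i\<in>I. bhattacharyya UNIV (p i) (q i)) =
      (\<Sum>g\<in>PiE I (\<lambda>_. UNIV). \<Prod>i\<in>I. sqrt (pmf (p i) (g i) * pmf (q i) (g i)))"
    unfolding bhattacharyya_def using assms by (intro prod_sum_PiE) auto
  also have "\<dots> = (\<Sum>f\<in>PiE_dflt I d (\<lambda>_. UNIV).
      sqrt (pmf (Pi_pmf I d p) f * pmf (Pi_pmf I d q) f))"
  \<comment> \<open>The distributive law sums over functions that are \<open>undefined\<close>
    outside \<open>I\<close>, whereas outcomes take the value \<open>d\<close> there; the bijection
    exchanges the two defaults.\<close>
  proof (rule sum.reindex_bij_witness[where i = "\<lambda>f. restrict f I"
        and j = "\<lambda>g i. if i \<in> I then g i else d"])
    fix g assume "g \<in> PiE I (\<lambda>_. UNIV :: 'b set)"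
    have "pmf (Pi_pmf I d r) (\<lambda>i. if i \<in> I then g i else d) = (\<Prod>i\<in>I. pmf (r i) (g i))"
      for r :: "'i \<Rightarrow> 'b pmf"
      using assms by (simp add: pmf_Pi')
    then show "sqrt (pmf (Pi_pmf I d p) (\<lambda>i. if i \<in> I then g i else d) *
        pmf (Pi_pmf I d q) (\<lambda>i. if i \<in> I then g i else d)) =
      (\<Prod>i\<in>I. sqrt (pmf (p i) (g i) * pmf (q i) (g i)))"
      by (simp only: sqrt_prod flip: prod.distrib)
  qed (auto simp: PiE_dflt_def PiE_def extensional_def fun_eq_iff)
  finally show ?thesis by (simp add: bhattacharyya_def)
qed

section \<open>Affinity of Bernoulli laws in terms of their logits\<close>

lemma tanh_sq_le: "(tanh t)\<^sup>2 \<le> t\<^sup>2" for t :: real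
proof -
  have le: "tanh u \<le> u" if "0 \<le> u" for u :: real
  proof -
    have "0 - tanh 0 \<le> u - tanh u"
    proof (rule DERIV_nonneg_imp_nondecreasing[OF that])
      fix x :: real
      have "((\<lambda>x. x - tanh x) has_real_derivative (tanh x)\<^sup>2) (at x)"
        by (auto intro!: derivative_eq_intros)
      then show "\<exists>y. ((\<lambda>x. x - tanh x) has_real_derivative y) (at x) \<and> 0 \<le> y"
        by (meson zero_le_power2)
    qed
    then show ?thesis by simp
  qed
  have "\<bar>tanh t\<bar> \<le> \<bar>t\<bar>"
    using le[of t] le[of "- t"] by (cases "0 \<le> t") auto
  then show ?thesis by (rule abs_le_square_iff[THEN iffD1])
qed

definition logistic :: "real \<Rightarrow> real" where
  "logistic \<eta> = 1 / (1 + exp (- \<eta>))"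

text \<open>With \<open>x\<close> and \<open>y\<close> the square roots of the odds, the squared
  affinity is a rational function and the tanh of a quarter of the logit gap is
  \<open>(x - y) / (x + y)\<close>. This reduces the comparison with tanh to a polynomial
  inequality.\<close>

lemma bhattacharyya_logistic:
  "1 - ((\<eta> - \<zeta>) / 4)\<^sup>2 \<le>
     (bhattacharyya UNIV (bernoulli_pmf (logistic \<eta>)) (bernoulli_pmf (logistic \<zeta>)))\<^sup>2"
proof -
  define x y where "x = exp (\<eta> / 2)" and "y = exp (\<zeta> / 2)"
  have pos: "0 < x" "0 < y" by (simp_all add: x_def y_def)
  have x2: "logistic \<eta> = x\<^sup>2 / (1 + x\<^sup>2)" "logistic \<zeta> = y\<^sup>2 / (1 + y\<^sup>2)"
    by (simp_all add: logistic_def x_def y_def exp_minus field_simps flip: exp_double)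
  have one: "1 - z\<^sup>2 / (1 + z\<^sup>2) = 1 / (1 + z\<^sup>2)" for z :: real
    by (simp add: field_simps add_pos_nonneg add_nonneg_eq_0_iff)
  have sq: "0 < 1 + z\<^sup>2" for z :: real by (simp add: add_pos_nonneg)
  define D where "D = sqrt ((1 + x\<^sup>2) * (1 + y\<^sup>2))"
  have "bhattacharyya UNIV (bernoulli_pmf (logistic \<eta>)) (bernoulli_pmf (logistic \<zeta>)) =
      sqrt (x\<^sup>2 / (1 + x\<^sup>2) * (y\<^sup>2 / (1 + y\<^sup>2))) + sqrt (1 / (1 + x\<^sup>2) * (1 / (1 + y\<^sup>2)))"
    unfolding bhattacharyya_def x2 using sq[of x] sq[of y]
    by (simp add: UNIV_bool one field_simps)
  also have "\<dots> = (x * y + 1) / D"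
    using pos by (simp add: D_def real_sqrt_mult real_sqrt_divide add_divide_distrib)
  finally have eq: "(bhattacharyya UNIV (bernoulli_pmf (logistic \<eta>))
      (bernoulli_pmf (logistic \<zeta>)))\<^sup>2 = (x * y + 1)\<^sup>2 / ((1 + x\<^sup>2) * (1 + y\<^sup>2))"
    using sq by (simp add: D_def power_divide)
  have "exp (- 2 * ((\<eta> - \<zeta>) / 4)) = y / x"
    by (simp add: x_def y_def field_simps flip: exp_diff)
  then have "tanh ((\<eta> - \<zeta>) / 4) = (1 - y / x) / (1 + y / x)"
    by (simp only: tanh_real_altdef)
  also have "\<dots> = ((x - y) / x) / ((x + y) / x)"
    using pos by (simp add: diff_divide_distrib add_divide_distrib)
  also have "\<dots> = (x - y) / (x + y)"
    using pos by simp
  finally have "tanh ((\<eta> - \<zeta>) / 4) = (x - y) / (x + y)" .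
  then have "1 - ((\<eta> - \<zeta>) / 4)\<^sup>2 \<le> 1 - ((x - y) / (x + y))\<^sup>2"
    using tanh_sq_le[of "(\<eta> - \<zeta>) / 4"] by simp
  also have "\<dots> = ((x + y)\<^sup>2 - (x - y)\<^sup>2) / (x + y)\<^sup>2"
    using pos by (simp add: power_divide diff_divide_distrib[of "(x + y)\<^sup>2"])
  also have "\<dots> = 4 * x * y / (x + y)\<^sup>2"
    by (simp add: power2_eq_square algebra_simps)
  also have "\<dots> \<le> (x * y + 1)\<^sup>2 / ((1 + x\<^sup>2) * (1 + y\<^sup>2))"
  proof -
    \<comment> \<open>With denominators cleared, the difference of the two sides is a perfect
      square.\<close>
    have "(x * y + 1)\<^sup>2 * (x + y)\<^sup>2 - 4 * x * y * ((1 + x\<^sup>2) * (1 + y\<^sup>2)) =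
        ((x - y) * (1 - x * y))\<^sup>2"
      by (simp add: power2_eq_square algebra_simps)
    then have "4 * x * y * ((1 + x\<^sup>2) * (1 + y\<^sup>2)) \<le> (x * y + 1)\<^sup>2 * (x + y)\<^sup>2"
      by (metis diff_ge_0_iff_ge zero_le_power2)
    then show ?thesis
      using pos sq[of x] sq[of y] by (simp add: divide_le_eq pos_le_divide_eq)
  qed
  finally show ?thesis unfolding eq .
qed

text \<open>Affinities multiply over independent coordinates, and by Weierstrass' inequality the
  product of their squares is at least one minus the sum of the deficits \<open>1 - b i\<close>.
  Each deficit is at most a sixteenth of the squared logit gap, hence the sum is at most
  4/16.\<close>

lemma bhattacharyya_logistic_product:
  assumes "finite I" "(\<Sum>i\<in>I. (\<eta> i - \<zeta> i)\<^sup>2) \<le> 4"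
  shows "3 / 4 \<le> (bhattacharyya (PiE_dflt I d (\<lambda>_. UNIV))
    (Pi_pmf I d (\<lambda>i. bernoulli_pmf (logistic (\<eta> i))))
    (Pi_pmf I d (\<lambda>i. bernoulli_pmf (logistic (\<zeta> i)))))\<^sup>2"
proof -
  define b where "b = (\<lambda>i. (bhattacharyya UNIV (bernoulli_pmf (logistic (\<eta> i)))
    (bernoulli_pmf (logistic (\<zeta> i))))\<^sup>2)"
  have b: "1 - b i \<le> (\<eta> i - \<zeta> i)\<^sup>2 / 16" "b i \<in> {0..1}" for i
    using bhattacharyya_logistic[of "\<eta> i" "\<zeta> i"]
    by (auto simp: b_def power_divide intro!: bhattacharyya_sq_le_1)
  have "(\<Sum>i\<in>I. 1 - b i) \<le> (\<Sum>i\<in>I. (\<eta> i - \<zeta> i)\<^sup>2) / 16"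
    unfolding sum_divide_distrib by (intro sum_mono b)
  with assms have "3 / 4 \<le> 1 - (\<Sum>i\<in>I. 1 - b i)" by simp
  also have "\<dots> \<le> (\<Prod>i\<in>I. 1 - (1 - b i))"
    using b by (intro Weierstrass_prod_ineq) auto
  finally show ?thesis
    using assms by (simp add: bhattacharyya_Pi_pmf b_def prod_power_distrib)
qed

section \<open>Leverages of the queries\<close>

locale btl_design =
  fixes d p l :: nat and M :: btl
  assumes setting: "btl_setting d p l M" and W_pos: "positive_definite (W_mat M)"
begin

definition dual_vec :: "query \<Rightarrow> real vec" where
  "dual_vec \<alpha> = the (mat_inverse (W_mat M)) *\<^sub>v q_vec M \<alpha>"

text \<open>The Gram matrix of the query vectors for the inner product given by the inverse of
  \<open>W_mat M\<close>.\<close>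

definition leverage :: "query \<Rightarrow> query \<Rightarrow> real" where
  "leverage \<alpha> \<beta> = scalar_prod (q_vec M \<alpha>) (dual_vec \<beta>)"

lemma finite_queries: "finite (queries M)"
proof (rule finite_subset)
  show "queries M \<subseteq> {..<d} \<times> {..<d}"
    using setting by (auto simp: btl_setting_def)
qed simp

lemma queries_nonempty: "queries M \<noteq> {}"
  using setting by (simp add: btl_setting_def)

lemma scale_pos: "0 < scale M"
  using setting by (simp add: btl_setting_def)

lemma sample_size_pos: "0 < sample_size M"
  unfolding sample_size_def
proof (rule ccontr)
  assume "\<not> 0 < sum (reps M) (queries M)"
  then have "\<forall>\<alpha>\<in>queries M. reps M \<alpha> = 0"
    using finite_queries by simp
  then show False
    using setting queries_nonempty by (auto simp: btl_setting_def)
qed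

lemma q_vec_carrier: "q_vec M \<alpha> \<in> carrier_vec (d_theta M)"
  using setting by (auto simp: btl_setting_def q_vec_def intro!: carrier_vecI)

lemma W_carrier: "W_mat M \<in> carrier_mat (d_theta M) (d_theta M)"
  by (simp add: W_mat_def)

lemma scalar_prod_W:
  assumes "x \<in> carrier_vec (d_theta M)" "z \<in> carrier_vec (d_theta M)"
  shows "scalar_prod x (W_mat M *\<^sub>v z) =
    (\<Sum>\<gamma>\<in>queries M. real (reps M \<gamma>) * scalar_prod (q_vec M \<gamma>) x * scalar_prod (q_vec M \<gamma>) z) /
    real (sample_size M)"
proof -
  let ?n = "d_theta M" and ?q = "\<lambda>\<gamma>. vec_index (q_vec M \<gamma>)" and ?N = "real (sample_size M)"
  \<comment> \<open>The summand of a triple sum; once the sum over queries is outermost, each of its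
    terms splits into two scalar products.\<close>
  define F where "F = (\<lambda>\<gamma> r s. real (reps M \<gamma>) / ?N *
    ((?q \<gamma> r * vec_index x r) * (?q \<gamma> s * vec_index z s)))"
  have dot: "scalar_prod (q_vec M \<gamma>) y = (\<Sum>r<?n. ?q \<gamma> r * vec_index y r)"
    if "y \<in> carrier_vec ?n" for \<gamma> and y :: "real vec"
    using that by (simp add: scalar_prod_def lessThan_atLeast0)
  have "scalar_prod x (W_mat M *\<^sub>v z) =
      (\<Sum>r<?n. vec_index x r * (\<Sum>s<?n. 1 / ?N *
        (\<Sum>\<gamma>\<in>queries M. real (reps M \<gamma>) * (?q \<gamma> r * ?q \<gamma> s)) * vec_index z s))"
    using assms by (simp add: scalar_prod_def W_mat_def lessThan_atLeast0)
  also have "\<dots> = (\<Sum>r<?n. \<Sum>s<?n. \<Sum>\<gamma>\<in>queries M. F \<gamma> r s)"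
    unfolding F_def sum_distrib_left sum_distrib_right
    by (intro sum.cong refl) (simp add: mult_ac)
  also have "\<dots> = (\<Sum>r<?n. \<Sum>\<gamma>\<in>queries M. \<Sum>s<?n. F \<gamma> r s)"
    by (intro sum.cong refl sum.swap)
  also have "\<dots> = (\<Sum>\<gamma>\<in>queries M. \<Sum>r<?n. \<Sum>s<?n. F \<gamma> r s)"
    by (rule sum.swap)
  also have "\<dots> = (\<Sum>\<gamma>\<in>queries M. real (reps M \<gamma>) / ?N *
      ((\<Sum>r<?n. ?q \<gamma> r * vec_index x r) * (\<Sum>s<?n. ?q \<gamma> s * vec_index z s)))"
    unfolding F_def sum_product by (simp only: sum_distrib_left)
  finally show ?thesis
    using assms by (simp add: dot sum_divide_distrib mult.assoc)
qed

text \<open>A nonzero kernel vector would annihilate the quadratic form, against positive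
  definiteness. So \<open>the\<close> in \<open>dual_vec\<close> and \<open>mu_Q\<close> picks a
  genuine inverse.\<close>

lemma mat_inverse_W:
  obtains X where "mat_inverse (W_mat M) = Some X" "X \<in> carrier_mat (d_theta M) (d_theta M)"
    "W_mat M * X = 1\<^sub>m (d_theta M)"
proof -
  have "det (W_mat M) \<noteq> 0"
  proof
    assume "det (W_mat M) = 0"
    then obtain v where v: "v \<in> carrier_vec (d_theta M)" "v \<noteq> 0\<^sub>v (d_theta M)"
      "W_mat M *\<^sub>v v = 0\<^sub>v (d_theta M)"
      using det_0_iff_vec_prod_zero[OF W_carrier] by blast
    then have "0 < scalar_prod v (W_mat M *\<^sub>v v)"
      using W_pos W_carrier by (auto simp: positive_definite_def)
    with v show False by simp
  qed
  then have "W_mat M \<in> Units (ring_mat TYPE(real) (d_theta M) ())"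
    by (rule det_non_zero_imp_unit[OF W_carrier])
  then obtain X where "mat_inverse (W_mat M) = Some X"
    using mat_inverse(1)[OF W_carrier, where b = "()"] by (cases "mat_inverse (W_mat M)") auto
  with mat_inverse(2)[OF W_carrier this] show thesis by (intro that) auto
qed

lemma dual_vec_carrier: "dual_vec \<alpha> \<in> carrier_vec (d_theta M)"
  and W_dual_vec: "W_mat M *\<^sub>v dual_vec \<alpha> = q_vec M \<alpha>"
proof -
  obtain X where X: "mat_inverse (W_mat M) = Some X" "X \<in> carrier_mat (d_theta M) (d_theta M)"
    "W_mat M * X = 1\<^sub>m (d_theta M)"
    by (rule mat_inverse_W)
  show "dual_vec \<alpha> \<in> carrier_vec (d_theta M)"
    using X q_vec_carrier by (simp add: dual_vec_def)
  have "W_mat M *\<^sub>v (X *\<^sub>v q_vec M \<alpha>) = (W_mat M * X) *\<^sub>v q_vec M \<alpha>"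
    by (rule assoc_mult_mat_vec[symmetric, OF W_carrier X(2) q_vec_carrier])
  then show "W_mat M *\<^sub>v dual_vec \<alpha> = q_vec M \<alpha>"
    using X q_vec_carrier by (simp add: dual_vec_def)
qed

text \<open>Inserting \<open>W_mat M\<close> between two copies of its inverse makes the Gram matrix
  reproduce itself. On the diagonal this is an energy: the average over all observations of the
  squared leverages against \<alpha>.\<close>

lemma leverage_eq:
  "leverage \<alpha> \<beta> = (\<Sum>\<gamma>\<in>queries M. real (reps M \<gamma>) * leverage \<gamma> \<alpha> * leverage \<gamma> \<beta>) / real (sample_size M)"
proof -
  have "leverage \<alpha> \<beta> = scalar_prod (dual_vec \<beta>) (W_mat M *\<^sub>v dual_vec \<alpha>)"
    unfolding leverage_def W_dual_vec
    by (rule comm_scalar_prod[OF q_vec_carrier dual_vec_carrier])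
  then show ?thesis
    by (simp add: scalar_prod_W dual_vec_carrier leverage_def mult_ac)
qed

lemma leverage_nonneg: "0 \<le> leverage \<alpha> \<alpha>"
  unfolding leverage_eq[of \<alpha> \<alpha>] by (simp add: sum_nonneg mult.assoc)

text \<open>Cauchy-Schwarz in additive form, obtained from the inequality of arithmetic and
  geometric means in each term of \<open>leverage_eq\<close>. Against a maximal diagonal entry the
  additive form suffices.\<close>

lemma abs_leverage_le: "2 * \<bar>leverage \<alpha> \<beta>\<bar> \<le> leverage \<alpha> \<alpha> + leverage \<beta> \<beta>"
proof -
  have amgm: "2 * \<bar>a * b\<bar> \<le> a * a + b * b" for a b :: real
    using zero_le_power2[of "\<bar>a\<bar> - \<bar>b\<bar>"]
    by (simp add: power2_eq_square algebra_simps abs_mult)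
  have "2 * \<bar>\<Sum>\<gamma>\<in>queries M. real (reps M \<gamma>) * leverage \<gamma> \<alpha> * leverage \<gamma> \<beta>\<bar> \<le>
      2 * (\<Sum>\<gamma>\<in>queries M. \<bar>real (reps M \<gamma>) * leverage \<gamma> \<alpha> * leverage \<gamma> \<beta>\<bar>)"
    by (intro mult_left_mono sum_abs) simp
  also have "\<dots> = (\<Sum>\<gamma>\<in>queries M. real (reps M \<gamma>) * (2 * \<bar>leverage \<gamma> \<alpha> * leverage \<gamma> \<beta>\<bar>))"
    by (simp add: sum_distrib_left abs_mult mult_ac)
  also have "\<dots> \<le> (\<Sum>\<gamma>\<in>queries M. real (reps M \<gamma>) *
      (leverage \<gamma> \<alpha> * leverage \<gamma> \<alpha> + leverage \<gamma> \<beta> * leverage \<gamma> \<beta>))"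
    by (intro sum_mono mult_left_mono amgm) simp
  finally show ?thesis
    unfolding leverage_eq[of \<alpha> \<alpha>] leverage_eq[of \<beta> \<beta>] leverage_eq[of \<alpha> \<beta>]
    using sample_size_pos
    by (simp add: field_simps sum.distrib)
qed

lemma max_leverage:
  obtains \<alpha> where "\<alpha> \<in> queries M" "mu_Q M * real (d_theta M) = leverage \<alpha> \<alpha>"
    "\<And>\<beta>. \<beta> \<in> queries M \<Longrightarrow> \<bar>leverage \<beta> \<alpha>\<bar> \<le> leverage \<alpha> \<alpha>"
proof -
  let ?f = "\<lambda>\<alpha>. 1 / real (d_theta M) * leverage \<alpha> \<alpha>"
  have dpos: "0 < real (d_theta M)"
    using setting by (simp add: btl_setting_def)
  have mu: "mu_Q M = Max (?f ` queries M)"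
    by (simp add: mu_Q_def leverage_def dual_vec_def)
  then have "mu_Q M \<in> ?f ` queries M"
    using finite_queries queries_nonempty by simp
  then obtain \<alpha> where \<alpha>: "\<alpha> \<in> queries M" "mu_Q M = ?f \<alpha>" by blast
  have "\<bar>leverage \<beta> \<alpha>\<bar> \<le> leverage \<alpha> \<alpha>" if "\<beta> \<in> queries M" for \<beta>
  proof -
    have "?f \<beta> \<le> mu_Q M"
      unfolding mu using that finite_queries by (intro Max_ge) auto
    then have "leverage \<beta> \<beta> \<le> leverage \<alpha> \<alpha>"
      using \<alpha> dpos by (simp add: divide_le_cancel)
    with abs_leverage_le[of \<beta> \<alpha>] show ?thesis by simp
  qed
  with \<alpha> dpos that show thesis by simp
qed

lemma min_rate_nonneg: "0 \<le> min_rate M B"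
proof -
  obtain \<alpha> where "mu_Q M * real (d_theta M) = leverage \<alpha> \<alpha>"
    by (rule max_leverage) (rule that)
  then show ?thesis
    using leverage_nonneg[of \<alpha>] by (simp add: min_rate_def)
qed

text \<open>The properties of \<open>v\<close> serve, in order, to separate the two points at
  \<alpha>, to keep both feasible, and to make their samples hard to distinguish.\<close>

lemma least_favourable_direction:
  obtains \<alpha> v where "\<alpha> \<in> queries M" "v \<in> carrier_vec (d_theta M)"
    "scalar_prod (q_vec M \<alpha>) v = sqrt (min_rate M B)"
    "\<And>\<beta>. \<beta> \<in> queries M \<Longrightarrow> \<bar>scalar_prod (q_vec M \<beta>) v\<bar> \<le> sqrt (min_rate M B)"
    "(\<Sum>\<beta>\<in>queries M. real (reps M \<beta>) * (scalar_prod (q_vec M \<beta>) v)\<^sup>2) \<le> (scale M)\<^sup>2"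
proof -
  obtain \<alpha> where \<alpha>: "\<alpha> \<in> queries M" "mu_Q M * real (d_theta M) = leverage \<alpha> \<alpha>"
    "\<And>\<beta>. \<beta> \<in> queries M \<Longrightarrow> \<bar>leverage \<beta> \<alpha>\<bar> \<le> leverage \<alpha> \<alpha>"
    by (rule max_leverage) (rule that)
  define L where "L = leverage \<alpha> \<alpha>"
  define N where "N = real (sample_size M)"
  define c where "c = sqrt (min_rate M B) / L"
  have N: "0 < N" using sample_size_pos by (simp add: N_def)
  have L: "0 \<le> L" by (simp add: L_def leverage_nonneg)
  have c: "0 \<le> c" using L min_rate_nonneg by (simp add: c_def)
  have rate: "min_rate M B \<le> L * (scale M)\<^sup>2 / N"
    by (simp add: min_rate_def \<alpha> L_def N_def)
  \<comment> \<open>If \<open>L = 0\<close> then the rate vanishes too, so the junk value \<open>c = 0\<close> is the right one.\<close>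
  have cL: "c * L = sqrt (min_rate M B)"
    using rate min_rate_nonneg[of B] by (cases "L = 0") (auto simp: c_def)
  have dot: "scalar_prod (q_vec M \<beta>) (c \<cdot>\<^sub>v dual_vec \<alpha>) = c * leverage \<beta> \<alpha>" for \<beta>
    unfolding leverage_def by (rule scalar_prod_smult_distrib[OF q_vec_carrier dual_vec_carrier])
  have "(\<Sum>\<beta>\<in>queries M. real (reps M \<beta>) * (c * leverage \<beta> \<alpha>)\<^sup>2) =
      c\<^sup>2 * (\<Sum>\<beta>\<in>queries M. real (reps M \<beta>) * leverage \<beta> \<alpha> * leverage \<beta> \<alpha>)"
    by (simp add: sum_distrib_left power2_eq_square mult_ac)
  also have "\<dots> = c\<^sup>2 * (N * L)"
    using leverage_eq[of \<alpha> \<alpha>] N by (simp add: L_def N_def)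
  also have "\<dots> \<le> (scale M)\<^sup>2"
  \<comment> \<open>If \<open>L\<close> is nonzero, the energy equals
    \<open>min_rate M B * N / L\<close>, which the first term of the minimum in
    \<open>min_rate\<close> bounds by the squared scale.\<close>
  proof (cases "L = 0")
    case False
    then have "c\<^sup>2 * (N * L) = min_rate M B * N / L"
      using min_rate_nonneg by (simp add: c_def power_divide power2_eq_square)
    also have "\<dots> \<le> (scale M)\<^sup>2"
      using rate N L False by (simp add: field_simps)
    finally show ?thesis .
  qed simp
  finally have energy: "(\<Sum>\<beta>\<in>queries M. real (reps M \<beta>) * (c * leverage \<beta> \<alpha>)\<^sup>2) \<le> (scale M)\<^sup>2" .
  show thesis
  proof (rule that[of \<alpha> "c \<cdot>\<^sub>v dual_vec \<alpha>"])
    show "\<bar>scalar_prod (q_vec M \<beta>) (c \<cdot>\<^sub>v dual_vec \<alpha>)\<bar> \<le> sqrt (min_rate M B)"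
      if "\<beta> \<in> queries M" for \<beta>
      using mult_left_mono[OF \<alpha>(3)[OF that] c] c
      by (simp add: dot abs_mult flip: L_def cL)
  qed (use \<alpha> dual_vec_carrier energy cL in \<open>auto simp: dot L_def\<close>)
qed

section \<open>The two-point argument in the response model\<close>

lemma Theta_memI:
  assumes v: "v \<in> carrier_vec (d_theta M)" and B: "B0 M < B"
    and small: "\<And>\<beta>. \<beta> \<in> queries M \<Longrightarrow> \<bar>scalar_prod (q_vec M \<beta>) v\<bar> \<le> sqrt (min_rate M B)"
  shows "v \<in> Theta M B"
  unfolding Theta_def
proof (intro CollectI conjI ballI v)
  fix \<beta> assume \<beta>: "\<beta> \<in> queries M"
  have B0: "0 < B0 M" by (simp add: B0_def)
  then have ln: "ln (B / B0 M) = ln B - ln (B0 M)"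
    using B by (simp add: ln_div)
  have "0 \<le> ln (B / B0 M)"
    using B B0 by simp
  \<comment> \<open>The second term of the minimum enters here: it is the logit range left by
    \<open>B\<close> after the intercepts have used up to \<open>ln (B0 M)\<close>.\<close>
  then have "sqrt (min_rate M B) \<le> scale M * ln (B / B0 M)"
    using scale_pos by (intro real_le_lsqrt) (auto simp: min_rate_def power_mult_distrib)
  with small[OF \<beta>] have "\<bar>scalar_prod (q_vec M \<beta>) v / scale M\<bar> \<le> ln B - ln (B0 M)"
    using scale_pos by (simp add: ln field_simps)
  moreover have "\<bar>scalar_prod (w_o M) (a_vec M \<beta>) / scale M\<bar> \<le> ln (B0 M)"
    unfolding B0_def ln_exp using \<beta> finite_queries by (intro Max_ge) auto
  ultimately show "\<bar>eta M \<beta> v\<bar> \<le> ln B"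
    unfolding eta_def add_divide_distrib by linarith
qed

lemma finite_obs_index: "finite (obs_index M)"
  using finite_queries by (auto simp: obs_index_def)

lemma finite_responses: "finite (responses M)"
  using finite_obs_index by (auto simp: responses_def)

lemma set_response_pmf: "set_pmf (response_pmf M \<theta>) \<subseteq> responses M"
  unfolding response_pmf_def responses_def PiE_dflt_def
  using set_Pi_pmf_subset[OF finite_obs_index, of False] by fastforce

lemma response_pmf_eq: "response_pmf M \<theta> =
  Pi_pmf (obs_index M) False (\<lambda>i. bernoulli_pmf (logistic (eta M (fst i) \<theta>)))"
  unfolding response_pmf_def logistic_def case_prod_unfold ..

text \<open>All repetitions of a query share its logit, so its squared gap is counted
  \<open>reps M\<close> times in the sum over observations.\<close>

lemma bhattacharyya_response_pmf:
  assumes "(\<Sum>\<alpha>\<in>queries M. real (reps M \<alpha>) * (eta M \<alpha> \<theta> - eta M \<alpha> \<theta>')\<^sup>2) \<le> 4"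
  shows "3 / 4 \<le> (bhattacharyya (responses M) (response_pmf M \<theta>) (response_pmf M \<theta>'))\<^sup>2"
proof -
  have "(\<Sum>i\<in>obs_index M. (eta M (fst i) \<theta> - eta M (fst i) \<theta>')\<^sup>2) =
      (\<Sum>\<alpha>\<in>queries M. \<Sum>t\<in>{1..reps M \<alpha>}. (eta M \<alpha> \<theta> - eta M \<alpha> \<theta>')\<^sup>2)"
    unfolding obs_index_def using finite_queries by (subst sum.Sigma) (auto simp: case_prod_beta)
  with assms show ?thesis
    unfolding response_pmf_eq responses_def
    by (intro bhattacharyya_logistic_product finite_obs_index) simp
qed

lemma exists_hard_parameter:
  assumes B: "B0 M < B" and est: "\<And>y. y \<in> responses M \<Longrightarrow> est y \<in> carrier_vec (d_theta M)"
  shows "\<exists>\<theta>\<in>Theta M B. 1 / 4 \<le> measure_pmf.prob (response_pmf M \<theta>)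
    {y. min_rate M B \<le> (Q_norm M (est y - \<theta>))\<^sup>2}"
proof -
  obtain \<alpha> v where \<alpha>: "\<alpha> \<in> queries M" and v: "v \<in> carrier_vec (d_theta M)"
    and attained: "scalar_prod (q_vec M \<alpha>) v = sqrt (min_rate M B)"
    and small: "\<And>\<beta>. \<beta> \<in> queries M \<Longrightarrow> \<bar>scalar_prod (q_vec M \<beta>) v\<bar> \<le> sqrt (min_rate M B)"
    and energy: "(\<Sum>\<beta>\<in>queries M. real (reps M \<beta>) * (scalar_prod (q_vec M \<beta>) v)\<^sup>2) \<le> (scale M)\<^sup>2"
    by (rule least_favourable_direction[of B]) (rule that)
  define \<theta> where "\<theta> = (\<lambda>c :: real. c \<cdot>\<^sub>v v)"
  define E where "E = (\<lambda>c. {y. min_rate M B \<le> (Q_norm M (est y - \<theta> c))\<^sup>2})"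
  have \<theta>: "\<theta> c \<in> carrier_vec (d_theta M)" for c
    using v by (simp add: \<theta>_def)
  have dot: "scalar_prod (q_vec M \<beta>) (\<theta> c) = c * scalar_prod (q_vec M \<beta>) v" for \<beta> c
    unfolding \<theta>_def by (rule scalar_prod_smult_distrib[OF q_vec_carrier v])
  have mem: "\<theta> c \<in> Theta M B" if "\<bar>c\<bar> = 1" for c
    using \<theta> B small that by (intro Theta_memI) (auto simp: dot abs_mult)
  \<comment> \<open>The intercepts cancel in the difference; the factor 2 becomes the bound 4 once
    the energy of \<open>v\<close> is at most the squared scale.\<close>
  have "eta M \<beta> (\<theta> 1) - eta M \<beta> (\<theta> (-1)) = 2 * scalar_prod (q_vec M \<beta>) v / scale M" for \<beta>
    by (simp add: eta_def dot flip: diff_divide_distrib)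
  then have "(\<Sum>\<beta>\<in>queries M. real (reps M \<beta>) * (eta M \<beta> (\<theta> 1) - eta M \<beta> (\<theta> (-1)))\<^sup>2) =
      4 / (scale M)\<^sup>2 * (\<Sum>\<beta>\<in>queries M. real (reps M \<beta>) * (scalar_prod (q_vec M \<beta>) v)\<^sup>2)"
    by (simp add: sum_distrib_left power_divide power_mult_distrib mult_ac)
  also have "\<dots> \<le> 4"
    using energy scale_pos by (simp add: field_simps)
  finally have bc: "3 / 4 \<le> (bhattacharyya (responses M)
      (response_pmf M (\<theta> 1)) (response_pmf M (\<theta> (-1))))\<^sup>2"
    by (rule bhattacharyya_response_pmf)
  have far: "y \<in> E 1 \<or> y \<in> E (-1)" if y: "y \<in> responses M" for y
  proof -
    define t where "t = scalar_prod (q_vec M \<alpha>) (est y)"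
    have far_c: "y \<in> E c" if "sqrt (min_rate M B) \<le> \<bar>t - c * sqrt (min_rate M B)\<bar>" for c
    proof -
      have "scalar_prod (q_vec M \<alpha>) (est y - \<theta> c) = t - c * sqrt (min_rate M B)"
        using scalar_prod_minus_distrib[OF q_vec_carrier est[OF y] \<theta>]
        by (simp add: dot attained t_def)
      moreover have "\<bar>scalar_prod (q_vec M \<alpha>) (est y - \<theta> c)\<bar> \<le> Q_norm M (est y - \<theta> c)"
        unfolding Q_norm_def using \<alpha> finite_queries by (intro Max_ge) auto
      ultimately have "sqrt (min_rate M B) \<le> Q_norm M (est y - \<theta> c)"
        using that by simp
      then show ?thesis
        by (simp add: E_def sqrt_le_D)
    qed
    show ?thesis
      \<comment> \<open>An estimate with \<open>t\<close> nonnegative is far from the point with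
        value \<open>- sqrt (min_rate M B)\<close>, and one with \<open>t\<close> negative is far
        from the other.\<close>
      using far_c[of 1] far_c[of "-1"] min_rate_nonneg[of B] by (cases "0 \<le> t") auto
  qed
  \<comment> \<open>Here \<open>sqrt (1 - 3 / 4) = 1 / 2\<close>, so the two error probabilities add
    up to at least 1/2 and one of them reaches 1/4.\<close>
  have "sqrt (1 - (bhattacharyya (responses M)
      (response_pmf M (\<theta> 1)) (response_pmf M (\<theta> (-1))))\<^sup>2) \<le> 1 / 2"
    using bc by (intro real_le_lsqrt) (auto simp: power_divide)
  moreover have "responses M \<subseteq> E 1 \<union> E (-1)"
    using far by blast
  note le_cam_two_point[OF finite_responses set_response_pmf set_response_pmf this,
      of "\<theta> 1" "\<theta> (-1)"]
  ultimately have "1 / 2 \<le> measure_pmf.prob (response_pmf M (\<theta> 1)) (E 1) +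
      measure_pmf.prob (response_pmf M (\<theta> (-1))) (E (-1))"
    by linarith
  then have "1 / 4 \<le> measure_pmf.prob (response_pmf M (\<theta> 1)) (E 1) \<or>
      1 / 4 \<le> measure_pmf.prob (response_pmf M (\<theta> (-1))) (E (-1))"
    by linarith
  then show ?thesis
    using mem[of 1] mem[of "-1"] unfolding E_def by auto
qed

text \<open>Markov's inequality for the squared loss at the level
  \<open>min_rate M B\<close>.\<close>

lemma risk_ge:
  "ennreal (min_rate M B * measure_pmf.prob (response_pmf M \<theta>)
     {y. min_rate M B \<le> (Q_norm M (est y - \<theta>))\<^sup>2}) \<le> risk M est \<theta>"
proof -
  let ?E = "{y. min_rate M B \<le> (Q_norm M (est y - \<theta>))\<^sup>2}"
  have "ennreal (min_rate M B * measure_pmf.prob (response_pmf M \<theta>) ?E) =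
      (\<integral>\<^sup>+ y. ennreal (min_rate M B) * indicator ?E y \<partial>measure_pmf (response_pmf M \<theta>))"
    using min_rate_nonneg
    by (simp add: nn_integral_cmult_indicator measure_pmf.emeasure_eq_measure ennreal_mult)
  also have "\<dots> \<le> risk M est \<theta>"
    unfolding risk_def by (intro nn_integral_mono) (auto simp: indicator_def ennreal_leI)
  finally show ?thesis .
qed

end

theorem theorem3p2:
  shows "\<exists>c0 :: real. c0 > 0 \<and>
    (\<forall>(d :: nat) (p :: nat) (l :: nat) (M :: btl) (B :: real).
       btl_setting d p l M \<longrightarrow> B > 1 \<longrightarrow> B > B0 M \<longrightarrow> positive_definite (W_mat M) \<longrightarrow>
         (INF est \<in> estimators M B. SUP \<theta> \<in> Theta M B. risk M est \<theta>)
           \<ge> ennreal (c0 * min_rate M B) \<and>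
         (INF est \<in> estimators M B. SUP \<theta> \<in> Theta M B.
            emeasure (measure_pmf (response_pmf M \<theta>))
              {y. (Q_norm M (est y - \<theta>))\<^sup>2 \<ge> min_rate M B})
           \<ge> ennreal (1 / 4))"
\<comment> \<open>The constant is the error probability from \<open>exists_hard_parameter\<close>,
  by which Markov's inequality multiplies the rate.\<close>
proof (intro exI[of _ "1 / 4 :: real"] conjI allI impI)
  fix d p l :: nat and M :: btl and B :: real
  assume "btl_setting d p l M" "B0 M < B" "positive_definite (W_mat M)"
  then interpret btl_design d p l M by unfold_locales
  have hard: "\<exists>\<theta>\<in>Theta M B. 1 / 4 \<le> measure_pmf.prob (response_pmf M \<theta>)
      {y. min_rate M B \<le> (Q_norm M (est y - \<theta>))\<^sup>2}" if "est \<in> estimators M B" for est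
    using that \<open>B0 M < B\<close> by (intro exists_hard_parameter) (auto simp: estimators_def)
  show "ennreal (1 / 4 * min_rate M B) \<le>
      (INF est\<in>estimators M B. SUP \<theta>\<in>Theta M B. risk M est \<theta>)"
  proof (rule INF_greatest)
    fix est assume "est \<in> estimators M B"
    from hard[OF this] obtain \<theta> where \<theta>: "\<theta> \<in> Theta M B"
      "1 / 4 \<le> measure_pmf.prob (response_pmf M \<theta>)
        {y. min_rate M B \<le> (Q_norm M (est y - \<theta>))\<^sup>2}"
      by blast
    have "ennreal (1 / 4 * min_rate M B) \<le> risk M est \<theta>"
      using mult_left_mono[OF \<theta>(2) min_rate_nonneg[of B]]
      by (intro order_trans[OF ennreal_leI risk_ge]) simp
    with \<theta>(1) show "ennreal (1 / 4 * min_rate M B) \<le> (SUP \<theta>\<in>Theta M B. risk M est \<theta>)"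
      by (rule SUP_upper2)
  qed
  show "ennreal (1 / 4) \<le> (INF est\<in>estimators M B. SUP \<theta>\<in>Theta M B.
      emeasure (measure_pmf (response_pmf M \<theta>))
        {y. min_rate M B \<le> (Q_norm M (est y - \<theta>))\<^sup>2})"
  proof (rule INF_greatest)
    fix est assume "est \<in> estimators M B"
    from hard[OF this] obtain \<theta> where \<theta>: "\<theta> \<in> Theta M B"
      "1 / 4 \<le> measure_pmf.prob (response_pmf M \<theta>)
        {y. min_rate M B \<le> (Q_norm M (est y - \<theta>))\<^sup>2}"
      by blast
    have "ennreal (1 / 4) \<le> emeasure (measure_pmf (response_pmf M \<theta>))
        {y. min_rate M B \<le> (Q_norm M (est y - \<theta>))\<^sup>2}"
      unfolding measure_pmf.emeasure_eq_measure using \<theta>(2) by (rule ennreal_leI)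
    with \<theta>(1) show "ennreal (1 / 4) \<le> (SUP \<theta>\<in>Theta M B.
        emeasure (measure_pmf (response_pmf M \<theta>))
          {y. min_rate M B \<le> (Q_norm M (est y - \<theta>))\<^sup>2})"
      by (rule SUP_upper2)
  qed
qed simp

end
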